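(* Let $c\ge 2$, $1\le s\le c-1$ and let $n$ be a positive integer. Suppose $\lambda$ is an integer with $\lambda\equiv sn\pmod c$ and $1\le\lambda\le\min\{s,c-s\}$, and suppose $q>c-\lambda$. Then $f^q_{c,s}(n)\le q^{\lceil sn/c\rceil}$.
   Context: $[m]=\{1,\dots,m\}$. A code $\mathcal{C}\subseteq[q]^n$ is $(c,s)$-frameproof if for every $c+1$ codewords $\bm x^0,\dots,\bm x^c\in\mathcal{C}$ with $\bm x^0\neq\bm x^j$ for each $j\in[c]$ ($\bm x^1,\dots,\bm x^c$ not necessarily distinct), there is a coordinate $i\in[n]$ with $|\{j\in[c]:x^j_i=x^0_i\}|<s$. $f^q_{c,s}(n)$ is the maximum size of a $(c,s)$-frameproof code in $[q]^n$. *)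

theory Defs
  imports Complex_Main "HOL-Library.FuncSet" "HOL-Number_Theory.Cong"
begin

text \<open>Words over the alphabet \<open>{1..q}\<close> of length \<open>n\<close>; extensional functions, so that two words
  are equal iff they agree on all coordinates \<open>1, \<dots>, n\<close>.\<close>

definition words :: "nat \<Rightarrow> nat \<Rightarrow> (nat \<Rightarrow> nat) set" where
  "words q n = {1..n} \<rightarrow>\<^sub>E {1..q}"

text \<open>The family \<open>x 0, \<dots>, x c\<close> may repeat codewords; only \<open>x 0\<close> must differ from the others.\<close>

definition frameproof :: "nat \<Rightarrow> nat \<Rightarrow> nat \<Rightarrow> nat \<Rightarrow> (nat \<Rightarrow> nat) set \<Rightarrow> bool" where
  "frameproof q n c s C \<longleftrightarrow>
     C \<subseteq> words q n \<and>
     (\<forall>x :: nat \<Rightarrow> nat \<Rightarrow> nat.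
        (\<forall>j\<in>{0..c}. x j \<in> C) \<longrightarrow> (\<forall>j\<in>{1..c}. x 0 \<noteq> x j) \<longrightarrow>
        (\<exists>i\<in>{1..n}. card {j\<in>{1..c}. x j i = x 0 i} < s))"

definition max_frameproof :: "nat \<Rightarrow> nat \<Rightarrow> nat \<Rightarrow> nat \<Rightarrow> nat" where
  "max_frameproof q c s n = Max {card C | C. frameproof q n c s C}"

text \<open>The maximum is taken over a finite nonempty set, hence is attained.\<close>

lemma finite_words: "finite (words q n)"
  by (simp add: words_def finite_PiE)

lemma finite_frameproof_cards: "finite {card C | C. frameproof q n c s C}"
proof -
  have "{C. frameproof q n c s C} \<subseteq> Pow (words q n)"
    by (auto simp: frameproof_def)
  then have "finite {C. frameproof q n c s C}"
    by (rule finite_subset) (simp add: finite_words)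
  then show ?thesis by simp
qed

lemma frameproof_empty: "frameproof q n c s {}"
  by (auto simp: frameproof_def)

lemma max_frameproof_attained: "\<exists>C. frameproof q n c s C \<and> card C = max_frameproof q c s n"
proof -
  have "max_frameproof q c s n \<in> {card C | C. frameproof q n c s C}"
    unfolding max_frameproof_def
  proof (rule Max_in[OF finite_frameproof_cards])
    show "{card C | C. frameproof q n c s C} \<noteq> {}"
      using frameproof_empty by blast
  qed
  then show ?thesis by auto
qed

lemma card_le_max_frameproof: "frameproof q n c s C \<Longrightarrow> card C \<le> max_frameproof q c s n"
  unfolding max_frameproof_def by (rule Max_ge[OF finite_frameproof_cards]) blast

end

theory Submission
  imports Defs "HOL-Combinatorics.Permutations"
begin

text \<open>Write \<open>s n = c t + l\<close>, so that \<open>\<lceil>s n / c\<rceil> = t + 1\<close>, and call a set \<open>T\<close> of coordinates own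
  for a codeword \<open>x\<close> if no other codeword agrees with \<open>x\<close> on \<open>T\<close>. Since \<open>l \<le> s \<le> c - l\<close>, a set
  \<open>K\<close> of \<open>t + 1\<close> coordinates taken \<open>l\<close> times can be completed by \<open>c - l\<close> sets of size \<open>t\<close> to a
  family covering every coordinate \<open>s\<close> times. The frameproof property then forces \<open>K\<close> or one
  of the \<open>t\<close>-sets to be own for each codeword. Averaging over all permutations of the
  coordinates reduces the bound to \<open>|own K| + (c - l) |own T| \<le> q ^ (t + 1)\<close> for \<open>T \<subseteq> K\<close> with
  \<open>|T| = t\<close>, where \<open>|own S|\<close> counts the codewords for which \<open>S\<close> is own. This holds because
  \<open>c - l \<le> q - 1\<close> and a codeword for which \<open>T\<close> is own blocks \<open>q\<close> patterns on \<open>K\<close>.\<close>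

section \<open>Own sets and the patterns they block\<close>

definition own :: "('a \<Rightarrow> 'b) set \<Rightarrow> 'a set \<Rightarrow> ('a \<Rightarrow> 'b) set" where
  "own C T = {x \<in> C. \<forall>y\<in>C. (\<forall>i\<in>T. y i = x i) \<longrightarrow> y = x}"

lemma own_subset: "own C T \<subseteq> C"
  by (auto simp: own_def)

lemma own_mono: "S \<subseteq> T \<Longrightarrow> own C S \<subseteq> own C T"
  by (auto simp: own_def)

lemma inj_on_restrict_own: "inj_on (\<lambda>x. restrict x T) (own C T)"
proof (rule inj_onI)
  fix x y assume *: "x \<in> own C T" "y \<in> own C T" "restrict x T = restrict y T"
  then have "\<forall>i\<in>T. x i = y i"
    by (metis restrict_apply')
  with * show "x = y" by (auto simp: own_def)
qed

text \<open>Distinct words of \<open>own C (insert t T)\<close> have distinct patterns on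
  \<open>insert t T\<close>. Each word of \<open>own C T\<close> takes up all \<open>card A\<close>
  patterns that vary its value at \<open>t\<close>, since no other codeword has its pattern on
  \<open>T\<close>. These patterns are all counted inside
  \<open>insert t T \<rightarrow>\<^sub>E A\<close>.\<close>

lemma card_own_insert_le:
  fixes C :: "('a \<Rightarrow> 'b) set"
  assumes "C \<subseteq> I \<rightarrow>\<^sub>E A" "finite I" "finite A" "insert t T \<subseteq> I" "t \<notin> T"
  shows "card (own C (insert t T)) + (card A - 1) * card (own C T) \<le> card A ^ Suc (card T)"
proof (cases "own C T = {}")
  case False
  let ?K = "insert t T"
  let ?P = "(\<lambda>x. restrict x ?K) ` (own C ?K - own C T)"
  let ?h = "\<lambda>(z, a). (restrict z T)(t := a)"
  let ?Q = "?h ` (own C T \<times> A)"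
  have finT: "finite T" and finC: "finite C"
    using assms finite_subset[of C "I \<rightarrow>\<^sub>E A"] finite_subset[of T I] by (auto simp: finite_PiE)
  have fin: "finite (own C S)" for S
    using own_subset finC by (rule finite_subset)
  have val: "x i \<in> A" if "x \<in> C" "i \<in> ?K" for x i
    using that assms by (blast dest: PiE_mem)
  \<comment> \<open>A nonempty alphabet keeps the truncated difference \<open>card A - 1\<close>
    exact.\<close>
  from False obtain z where "z \<in> own C T" by blast
  then have "z t \<in> A" using val own_subset by blast
  then have A1: "card A \<ge> 1" using assms(3)
    by (metis One_nat_def Suc_leI card_gt_0_iff empty_iff)
  have sub: "own C T \<subseteq> own C ?K" by (rule own_mono) auto
  have "card ?P = card (own C ?K - own C T)"
    by (rule card_image, rule inj_on_subset[OF inj_on_restrict_own]) blast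
  also have "\<dots> = card (own C ?K) - card (own C T)"
    by (rule card_Diff_subset[OF fin sub])
  finally have cP: "card ?P = card (own C ?K) - card (own C T)" .
  have "inj_on ?h (own C T \<times> A)"
  proof (rule inj_onI, clarify)
    fix x a y b
    assume *: "x \<in> own C T" "y \<in> own C T" and e: "(restrict x T)(t := a) = (restrict y T)(t := b)"
    have "restrict x T i = restrict y T i" for i
      using fun_cong[OF e, of i] assms(5) by (cases "i = t") auto
    then have "x = y" using inj_on_restrict_own * by (metis ext inj_onD)
    moreover have "a = b" using fun_cong[OF e, of t] by simp
    ultimately show "x = y \<and> a = b" by simp
  qed
  then have cQ: "card ?Q = card (own C T) * card A"
    by (simp add: card_image card_cartesian_product)
  have disj: "?P \<inter> ?Q = {}"
  proof (rule ccontr)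
    assume "?P \<inter> ?Q \<noteq> {}"
    then obtain x z a where x: "x \<in> own C ?K" "x \<notin> own C T" and z: "z \<in> own C T"
      and e: "restrict x ?K = (restrict z T)(t := a)" by auto
    have "x i = z i" if "i \<in> T" for i
      using fun_cong[OF e, of i] that assms(5) by (auto split: if_splits)
    with x z have "x = z" by (auto simp: own_def)
    with x z show False by simp
  qed
  have "?P \<union> ?Q \<subseteq> ?K \<rightarrow>\<^sub>E A"
  proof -
    have "?P \<subseteq> ?K \<rightarrow>\<^sub>E A"
      unfolding image_subset_iff restrict_PiE_iff using val own_subset by blast
    moreover have "?Q \<subseteq> ?K \<rightarrow>\<^sub>E A" using val own_subset[of C T]
      by (auto simp: PiE_iff extensional_def subset_iff)
    ultimately show ?thesis by blast
  qed
  then have "card (?P \<union> ?Q) \<le> card (?K \<rightarrow>\<^sub>E A)"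
    using assms(3) finT by (intro card_mono) (auto simp: finite_PiE)
  also have "\<dots> = card A ^ Suc (card T)"
    using finT assms(5) by (simp add: card_PiE)
  finally have "card (own C ?K) - card (own C T) + card (own C T) * card A \<le> card A ^ Suc (card T)"
    using disj cP cQ fin assms(3) by (simp add: card_Un_disjoint)
  moreover have "card (own C T) \<le> card (own C ?K)" by (rule card_mono[OF fin sub])
  moreover have "card (own C T) * card A = card (own C T) + (card A - 1) * card (own C T)"
    using A1 by (cases "card A") auto
  ultimately show ?thesis by linarith
next
  case True
  have "finite T" using assms(2,4) finite_subset[of T I] by simp
  have "card (own C (insert t T)) = card ((\<lambda>x. restrict x (insert t T)) ` own C (insert t T))"
    by (simp add: card_image inj_on_restrict_own)
  also have "\<dots> \<le> card (insert t T \<rightarrow>\<^sub>E A)"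
  proof (rule card_mono)
    show "finite (insert t T \<rightarrow>\<^sub>E A)" using \<open>finite T\<close> assms(3) by (simp add: finite_PiE)
    have "x i \<in> A" if "x \<in> C" "i \<in> insert t T" for x i
      using that assms by (blast dest: PiE_mem)
    then show "(\<lambda>x. restrict x (insert t T)) ` own C (insert t T) \<subseteq> insert t T \<rightarrow>\<^sub>E A"
      unfolding image_subset_iff restrict_PiE_iff using own_subset by blast
  qed
  also have "\<dots> = card A ^ Suc (card T)"
    using \<open>finite T\<close> assms(5) by (simp add: card_PiE)
  finally show ?thesis using True by simp
qed

section \<open>Covers and permutations of the coordinates\<close>

text \<open>Lay out \<open>m i\<close> consecutive copies of each \<open>i\<close> in a row; the \<open>j\<close>-th set collects what lies
  at the positions congruent to \<open>j\<close> modulo \<open>d\<close>.\<close>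

lemma exists_cover_with_multiplicities:
  fixes m :: "nat \<Rightarrow> nat"
  assumes "0 < d" and m: "\<And>i. i \<in> {1..n} \<Longrightarrow> m i \<le> d" and sum: "(\<Sum>i=1..n. m i) \<le> d * t"
    and "t \<le> n"
  shows "\<exists>T. (\<forall>j<d. T j \<subseteq> {1..n} \<and> card (T j) = t) \<and>
             (\<forall>i\<in>{1..n}. m i \<le> card {j\<in>{..<d}. i \<in> T j})"
proof -
  \<comment> \<open>The block of \<open>i\<close> starts at position \<open>S i\<close>. The bound
    \<open>a < t\<close> keeps to the first \<open>d * t\<close> positions.\<close>
  define S where "S i = (\<Sum>i'\<in>{1..<i}. m i')" for i
  define U where "U j = {i\<in>{1..n}. \<exists>a<t. d * a + j \<in> {S i..<S i + m i}}" for j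
  have S_step: "S i + m i \<le> S i'" if "1 \<le> i" "i < i'" for i i'
  proof -
    have "S i + m i = (\<Sum>i'\<in>{1..<Suc i}. m i')" using that by (simp add: S_def)
    also have "\<dots> \<le> S i'" unfolding S_def using that by (intro sum_mono2) auto
    finally show ?thesis .
  qed
  have S_uniq: "i = i'" if "1 \<le> i" "1 \<le> i'" "p \<in> {S i..<S i + m i}" "p \<in> {S i'..<S i' + m i'}"
    for i i' p
    using S_step[of i i'] S_step[of i' i] that by (cases i i' rule: linorder_cases) auto
  have cU: "card (U j) \<le> t" for j
  proof -
    \<comment> \<open>Blocks are disjoint, so each \<open>a < t\<close> contributes at most one
      index to \<open>U j\<close>.\<close>
    define g where "g a = (THE i. 1 \<le> i \<and> d * a + j \<in> {S i..<S i + m i})" for a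
    have "U j \<subseteq> g ` {..<t}"
    proof
      fix i assume "i \<in> U j"
      then obtain a where a: "a < t" "1 \<le> i" "d * a + j \<in> {S i..<S i + m i}"
        by (auto simp: U_def)
      then have "g a = i" unfolding g_def using S_uniq by (intro the_equality) blast+
      with a show "i \<in> g ` {..<t}" by auto
    qed
    then have "card (U j) \<le> card {..<t}" by (intro surj_card_le) auto
    then show ?thesis by simp
  qed
  have cov: "m i \<le> card {j\<in>{..<d}. i \<in> U j}" if i: "i \<in> {1..n}" for i
  proof -
    \<comment> \<open>A block has at most \<open>d\<close> consecutive positions, hence pairwise
      distinct residues.\<close>
    have "inj_on (\<lambda>p. p mod d) {S i..<S i + m i}"
    proof (rule linorder_inj_onI')
      fix p p' assume "p \<in> {S i..<S i + m i}" "p' \<in> {S i..<S i + m i}" and less: "p < p'"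
      then have "p' - p < d" using m[OF i] by auto
      then have "\<not> d dvd p' - p" using less by (auto dest: dvd_imp_le)
      then show "p mod d \<noteq> p' mod d" using less
        by (metis less_imp_le mod_eq_dvd_iff_nat)
    qed
    then have "m i = card ((\<lambda>p. p mod d) ` {S i..<S i + m i})" by (simp add: card_image)
    also have "\<dots> \<le> card {j\<in>{..<d}. i \<in> U j}"
    proof (rule card_mono)
      show "(\<lambda>p. p mod d) ` {S i..<S i + m i} \<subseteq> {j\<in>{..<d}. i \<in> U j}"
      proof clarify
        fix p assume p: "p \<in> {S i..<S i + m i}"
        have "S (Suc n) \<le> d * t" using sum by (simp add: S_def atLeastLessThanSuc_atLeastAtMost)
        then have "p < d * t" using S_step[of i "Suc n"] i p by auto
        then have "p div d < t" by (simp add: less_mult_imp_div_less mult.commute)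
        moreover have "d * (p div d) + p mod d = p" by simp
        ultimately have "i \<in> U (p mod d)" unfolding U_def using i p
          by (metis (mono_tags, lifting) mem_Collect_eq)
        then show "p mod d \<in> {..<d} \<and> i \<in> U (p mod d)" using \<open>0 < d\<close> by simp
      qed
    qed simp
    finally show ?thesis .
  qed
  \<comment> \<open>Padding to exactly \<open>t\<close> elements only adds coverage; equal sizes
    make the sets interchangeable under permutations.\<close>
  have "\<exists>T. U j \<subseteq> T \<and> T \<subseteq> {1..n} \<and> card T = t" for j
  proof -
    have "U j \<subseteq> {1..n}" by (auto simp: U_def)
    moreover have "t \<le> card {1..n}" using \<open>t \<le> n\<close> by simp
    ultimately show ?thesis by (metis exists_subset_between cU finite_atLeastAtMost)
  qed
  then obtain T where T: "\<And>j. U j \<subseteq> T j" "\<And>j. T j \<subseteq> {1..n}" "\<And>j. card (T j) = t" by metis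
  have "m i \<le> card {j\<in>{..<d}. i \<in> T j}" if "i \<in> {1..n}" for i
  proof -
    have "card {j\<in>{..<d}. i \<in> U j} \<le> card {j\<in>{..<d}. i \<in> T j}"
      using T(1) by (intro card_mono) auto
    with cov[OF that] show ?thesis by linarith
  qed
  with T show ?thesis by blast
qed

text \<open>A bijection from \<open>S\<close> to \<open>T\<close> is glued to one between their
  complements in \<open>I\<close>.\<close>

lemma exists_permutation_image:
  assumes "finite I" "S \<subseteq> I" "T \<subseteq> I" "card S = card T"
  obtains p where "p permutes I" "p ` S = T"
proof -
  have fin: "finite S" "finite T" using assms finite_subset by auto
  obtain f where f: "bij_betw f S T"
    using finite_same_card_bij[OF fin assms(4)] by blast
  have "card (I - S) = card (I - T)" using assms fin by (simp add: card_Diff_subset)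
  then obtain g where g: "bij_betw g (I - S) (I - T)"
    using finite_same_card_bij assms(1) by (metis finite_Diff)
  define p where "p i = (if i \<in> S then f i else if i \<in> I then g i else i)" for i
  have pS: "bij_betw p S T" using f by (rule bij_betw_cong[THEN iffD1, rotated]) (simp add: p_def)
  have "bij_betw p (I - S) (I - T)"
    using g by (rule bij_betw_cong[THEN iffD1, rotated]) (auto simp: p_def)
  with pS have "bij_betw p (S \<union> (I - S)) (T \<union> (I - T))" by (rule bij_betw_combine) auto
  then have "bij_betw p I I" using assms(2,3) by (simp add: Un_absorb1)
  then have "p permutes I" by (rule bij_imp_permutes) (use assms(2) in \<open>auto simp: p_def\<close>)
  then show thesis using that pS by (auto simp: bij_betw_def)
qed

section \<open>From the frameproof property to own sets\<close>

text \<open>Otherwise some codeword other than \<open>x\<close> agrees with \<open>x\<close> on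
  \<open>K\<close>, and another on each \<open>T j\<close>. Taking the first \<open>l\<close> times
  yields \<open>c\<close> codewords that match \<open>x\<close> at least \<open>s\<close> times in
  every coordinate.\<close>

lemma frameproof_own_cover:
  assumes "frameproof q n c s C" "l \<le> s" "s \<le> c" "x \<in> C"
    and cov: "\<And>i. i \<in> {1..n} \<Longrightarrow> (if i \<in> K then s - l else s) \<le> card {j\<in>{..<c - l}. i \<in> T j}"
  shows "x \<in> own C K \<or> (\<exists>j<c - l. x \<in> own C (T j))"
proof (rule ccontr)
  assume not: "\<not> ?thesis"
  have "\<exists>y. y \<in> C \<and> (\<forall>i\<in>K. y i = x i) \<and> y \<noteq> x" using not assms(4) by (auto simp: own_def)
  then obtain y where y: "y \<in> C" "\<And>i. i \<in> K \<Longrightarrow> y i = x i" "y \<noteq> x" by blast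
  have "\<forall>j. \<exists>z. j < c - l \<longrightarrow> z \<in> C \<and> (\<forall>i\<in>T j. z i = x i) \<and> z \<noteq> x"
    using not assms(4) by (auto simp: own_def)
  then obtain z where z: "\<And>j. j < c - l \<Longrightarrow> z j \<in> C \<and> (\<forall>i\<in>T j. z j i = x i) \<and> z j \<noteq> x"
    by metis
  \<comment> \<open>Indices \<open>1\<close> to \<open>l\<close> repeat \<open>y\<close>; indices
    \<open>l + 1\<close> to \<open>c\<close> run through \<open>z 0\<close> to
    \<open>z (c - l - 1)\<close>.\<close>
  define X where "X j = (if j = 0 then x else if j \<le> l then y else z (j - Suc l))" for j
  have zj: "z (j - Suc l) \<in> C \<and> z (j - Suc l) \<noteq> x" if "\<not> j \<le> l" "j \<le> c" for j
    using z[of "j - Suc l"] that by auto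
  have "\<forall>j\<in>{0..c}. X j \<in> C" using y(1) zj assms(4) by (simp add: X_def)
  moreover have "\<forall>j\<in>{1..c}. X 0 \<noteq> X j"
  proof
    fix j assume "j \<in> {1..c}"
    then show "X 0 \<noteq> X j" using y(3) zj[of j] by (auto simp: X_def)
  qed
  ultimately obtain i where i: "i \<in> {1..n}" and less: "card {j\<in>{1..c}. X j i = X 0 i} < s"
    using assms(1) unfolding frameproof_def by blast
  let ?P = "if i \<in> K then {1..l} else {}"
  let ?Q = "(\<lambda>j. j + Suc l) ` {j\<in>{..<c - l}. i \<in> T j}"
  have "?P \<union> ?Q \<subseteq> {j\<in>{1..c}. X j i = X 0 i}"
    using y(2) z assms(2,3) by (auto simp: X_def)
  then have "card (?P \<union> ?Q) \<le> card {j\<in>{1..c}. X j i = X 0 i}" by (intro card_mono) auto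
  moreover have "card (?P \<union> ?Q) = card ?P + card ?Q" by (rule card_Un_disjoint) auto
  moreover have "card ?Q = card {j\<in>{..<c - l}. i \<in> T j}" by (rule card_image) (simp add: inj_on_def)
  ultimately show False using cov[OF i] less assms(2) by (auto split: if_splits)
qed

section \<open>Averaging over permutations\<close>

lemma card_frameproof_le:
  assumes fp: "frameproof q n c s C" and "1 \<le> l" "l \<le> s" "s + l \<le> c" "c < q + l"
    and sn: "s * n = c * t + l"
  shows "card C \<le> q ^ Suc t"
proof -
  let ?I = "{1..n}" let ?d = "c - l"
  let ?K = "{1..Suc t}" let ?S = "{1..t}"
  let ?\<Pi> = "{p. p permutes ?I}"
  let ?m = "\<lambda>i. if i \<in> ?K then s - l else s"
  have CI: "C \<subseteq> ?I \<rightarrow>\<^sub>E {1..q}" using fp by (simp add: frameproof_def words_def)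
  then have finC: "finite C" by (rule finite_subset) (simp add: finite_PiE)
  \<comment> \<open>Strictness, due to \<open>1 \<le> l\<close>, leaves room for a set of
    \<open>t + 1\<close> coordinates.\<close>
  have "c * t < c * n"
  proof -
    have "s * n \<le> c * n" using assms by (intro mult_le_mono1) simp
    with sn \<open>1 \<le> l\<close> show ?thesis by linarith
  qed
  then have tn: "t < n" by simp
  have KI: "?K \<subseteq> ?I" using tn by auto
  \<comment> \<open>The demand left after \<open>l\<close> copies of \<open>?K\<close> is
    \<open>s * n - l * (t + 1) = (c - l) * t\<close>, exactly what \<open>?d\<close> sets of size
    \<open>t\<close> supply.\<close>
  have "(\<Sum>i\<in>?I. ?m i) + l * Suc t = (\<Sum>i\<in>?I. ?m i) + (\<Sum>i\<in>?I. if i \<in> ?K then l else 0)"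
    using KI sum.inter_restrict[of ?I "\<lambda>_. l" ?K, symmetric] by (simp add: Int_absorb1 min_absorb2)
  also have "\<dots> = (\<Sum>i\<in>?I. s)"
    unfolding sum.distrib[symmetric] using \<open>l \<le> s\<close> by (intro sum.cong) auto
  also have "\<dots> = ?d * t + l * Suc t"
  proof -
    have "c * t = ?d * t + l * t"
      using \<open>s + l \<le> c\<close> by (simp flip: distrib_right)
    with sn show ?thesis by (simp add: mult.commute)
  qed
  finally have sum: "(\<Sum>i\<in>?I. ?m i) \<le> ?d * t" by simp
  have d: "0 < ?d" and m: "?m i \<le> ?d" and "t \<le> n" for i using assms tn by auto
  obtain T where T: "\<forall>j<?d. T j \<subseteq> ?I \<and> card (T j) = t"
    and cov: "\<forall>i\<in>?I. ?m i \<le> card {j\<in>{..<?d}. i \<in> T j}"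
    using exists_cover_with_multiplicities[OF d m sum \<open>t \<le> n\<close>] by (elim exE conjE)

  have cover: "card C \<le> card (own C (p ` ?K)) + (\<Sum>j<?d. card (own C (p ` T j)))"
    if p: "p permutes ?I" for p
  proof -
    \<comment> \<open>Injectivity of \<open>p\<close> carries the multiplicities of the cover over
      to its image.\<close>
    have cov': "(if i \<in> p ` ?K then s - l else s) \<le> card {j\<in>{..<?d}. i \<in> p ` T j}"
      if "i \<in> ?I" for i
    proof -
      have "i \<in> p ` ?I" using that by (simp only: permutes_image[OF p])
      then obtain i' where i': "i = p i'" "i' \<in> ?I" by (rule imageE)
      then show ?thesis
        using bspec[OF cov i'(2)] by (simp only: i'(1) inj_image_mem_iff[OF permutes_inj[OF p]])
    qed
    have "s \<le> c" using \<open>s + l \<le> c\<close> by simp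
    have "C \<subseteq> own C (p ` ?K) \<union> (\<Union>j<?d. own C (p ` T j))"
    proof
      fix x assume "x \<in> C"
      from frameproof_own_cover[OF fp \<open>l \<le> s\<close> \<open>s \<le> c\<close> this, of "p ` ?K" "\<lambda>j. p ` T j", OF cov']
      show "x \<in> own C (p ` ?K) \<union> (\<Union>j<?d. own C (p ` T j))" by blast
    qed
    moreover have fin: "finite (own C S)" for S using own_subset finC by (rule finite_subset)
    ultimately have "card C \<le> card (own C (p ` ?K) \<union> (\<Union>j<?d. own C (p ` T j)))"
      by (intro card_mono) auto
    also have "\<dots> \<le> card (own C (p ` ?K)) + card (\<Union>j<?d. own C (p ` T j))"
      by (rule card_Un_le)
    also have "card (\<Union>j<?d. own C (p ` T j)) \<le> (\<Sum>j<?d. card (own C (p ` T j)))"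
      by (rule card_UN_le) simp
    finally show ?thesis by simp
  qed
  have avg: "(\<Sum>p\<in>?\<Pi>. card (own C (p ` T j))) = (\<Sum>p\<in>?\<Pi>. card (own C (p ` ?S)))"
    if j: "j < ?d" for j
  proof -
    obtain r where r: "r permutes ?I" "r ` ?S = T j"
      using exists_permutation_image[of ?I ?S "T j"] T j tn by auto
    have "(\<Sum>p\<in>?\<Pi>. card (own C (p ` ?S))) = (\<Sum>p\<in>?\<Pi>. card (own C ((p \<circ> r) ` ?S)))"
      by (rule sum_permutations_compose_right[OF r(1)])
    then show ?thesis by (simp only: image_comp[symmetric] r(2))
  qed
  have pair: "card (own C (p ` ?K)) + ?d * card (own C (p ` ?S)) \<le> q ^ Suc t"
    if p: "p permutes ?I" for p
  proof -
    have K: "p ` ?K = insert (p (Suc t)) (p ` ?S)" by (auto simp: atLeastAtMostSuc_conv)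
    have "p (Suc t) \<notin> p ` ?S"
      by (simp add: inj_image_mem_iff[OF permutes_inj[OF p]])
    moreover have "p ` ?K \<subseteq> ?I" using KI permutes_image[OF p] by blast
    moreover have "card (p ` ?S) = t" by (simp add: card_image permutes_inj_on[OF p])
    ultimately have "card (own C (p ` ?K)) + (q - 1) * card (own C (p ` ?S)) \<le> q ^ Suc t"
      using card_own_insert_le[OF CI, of "p (Suc t)" "p ` ?S"] unfolding K by simp
    moreover have "?d * card (own C (p ` ?S)) \<le> (q - 1) * card (own C (p ` ?S))"
      using \<open>c < q + l\<close> by (intro mult_le_mono1) simp
    ultimately show ?thesis by linarith
  qed
  have "card ?\<Pi> * card C \<le> (\<Sum>p\<in>?\<Pi>. card (own C (p ` ?K)) + (\<Sum>j<?d. card (own C (p ` T j))))"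
    using sum_mono[of ?\<Pi> "\<lambda>_. card C"] cover by simp
  also have "\<dots> = (\<Sum>p\<in>?\<Pi>. card (own C (p ` ?K))) + (\<Sum>j<?d. \<Sum>p\<in>?\<Pi>. card (own C (p ` T j)))"
    unfolding sum.distrib by (rule arg_cong[OF sum.swap])
  also have "\<dots> = (\<Sum>p\<in>?\<Pi>. card (own C (p ` ?K))) + (\<Sum>j<?d. \<Sum>p\<in>?\<Pi>. card (own C (p ` ?S)))"
    by (rule arg_cong[OF sum.cong]) (simp_all only: avg lessThan_iff)
  also have "\<dots> = (\<Sum>p\<in>?\<Pi>. card (own C (p ` ?K)) + ?d * card (own C (p ` ?S)))"
    by (simp add: sum.distrib sum_distrib_left)
  also have "\<dots> \<le> card ?\<Pi> * q ^ Suc t"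
    using sum_mono[of ?\<Pi> _ "\<lambda>_. q ^ Suc t"] pair by simp
  \<comment> \<open>The common factor \<open>card ?\<Pi>\<close> is \<open>fact n\<close>, which is
    positive and cancels.\<close>
  finally show ?thesis by (simp add: card_permutations[OF refl])
qed

theorem theorem3p3:
  fixes c s n q :: nat and l :: int
  assumes "c \<ge> 2"
    and "1 \<le> s" and "s \<le> c - 1"
    and "n \<ge> 1"
    and "[l = int s * int n] (mod int c)"
    and "1 \<le> l" and "l \<le> min (int s) (int c - int s)"
    and "int q > int c - l"
  shows "max_frameproof q c s n \<le> q ^ nat \<lceil>real (s * n) / real c\<rceil>"
proof -
  obtain k where k: "l = int k" using assms(6) by (metis nonneg_int_cases order_trans zero_le_one)
  \<comment> \<open>This makes \<open>s * n - k\<close> an exact difference, so that the congruence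
    becomes divisibility by \<open>c\<close>.\<close>
  have "k \<le> s * n" using assms(4,7) k by (simp add: le_trans[of k s])
  moreover have "[k = s * n] (mod c)" using assms(5) k by (simp flip: cong_int_iff)
  ultimately have "c dvd s * n - k" by (metis cong_altdef_nat cong_sym)
  then obtain t where "s * n - k = c * t" by (elim dvdE)
  with \<open>k \<le> s * n\<close> have t: "s * n = c * t + k" by simp
  \<comment> \<open>The fraction is \<open>t + k / c\<close> with \<open>0 < k / c \<le> 1\<close>,
    so it rounds up to \<open>t + 1\<close>.\<close>
  have "\<lceil>real (s * n) / real c\<rceil> = int t + 1"
    unfolding t by (rule ceiling_unique) (use assms k in \<open>auto simp: field_simps\<close>)
  moreover obtain C where "frameproof q n c s C" "card C = max_frameproof q c s n"
    using max_frameproof_attained by blast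
  ultimately show ?thesis
    using card_frameproof_le[of q n c s C k t] t assms(6,7,8) k by (simp add: nat_add_distrib)
qed

end
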